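(* For any tree $T$ of order $n\ge 2$, $i_{\{R2\}}(T)\ge i(T)+1$.
   Context: $i(T)$ is the independent domination number: the minimum cardinality of a set that is both independent and dominating in $T$. A Roman $\{2\}$-dominating function on a graph $G=(V,E)$ is a function $g:V\to\{0,1,2\}$ such that every $v$ with $g(v)=0$ satisfies $\sum_{u\in N(v)}g(u)\ge 2$; it is independent if $\{v:g(v)>0\}$ is an independent set. $i_{\{R2\}}(G)$ is the minimum weight $\sum_v g(v)$ of an independent Roman $\{2\}$-dominating function on $G$. *)

theory Defs
  imports "Graph_Theory.Digraph_Component"
begin

text \<open>
  Finite simple undirected graphs are the locale \<^locale>\<open>graph\<close>: finite, loop-free
  digraphs without parallel arcs whose adjacency relation is symmetric.
  The library predicate \<^const>\<open>tree\<close> is not usable for them, since \<^const>\<open>pre_digraph.cycle\<close>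
  admits going back and forth along one edge, so that a symmetric digraph with an edge is
  never a \<^const>\<open>forest\<close>. Cycles of the undirected graph are the directed cycles of length
  at least 3.
\<close>

definition undirected_tree :: "('a, 'b) pre_digraph \<Rightarrow> bool" where
  "undirected_tree G \<longleftrightarrow>
     graph G \<and> connected G \<and> \<not> (\<exists>p. pre_digraph.cycle G p \<and> 3 \<le> length p)"

definition neighborhood :: "('a, 'b) pre_digraph \<Rightarrow> 'a \<Rightarrow> 'a set" where
  "neighborhood G v = {u \<in> verts G. v \<rightarrow>\<^bsub>G\<^esub> u}"

definition independent_set :: "('a, 'b) pre_digraph \<Rightarrow> 'a set \<Rightarrow> bool" where
  "independent_set G S \<longleftrightarrow> S \<subseteq> verts G \<and> (\<forall>u\<in>S. \<forall>v\<in>S. \<not> u \<rightarrow>\<^bsub>G\<^esub> v)"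

definition dominating_set :: "('a, 'b) pre_digraph \<Rightarrow> 'a set \<Rightarrow> bool" where
  "dominating_set G S \<longleftrightarrow>
     S \<subseteq> verts G \<and> (\<forall>v\<in>verts G - S. neighborhood G v \<inter> S \<noteq> {})"

definition indep_dom_number :: "('a, 'b) pre_digraph \<Rightarrow> nat" where
  "indep_dom_number G =
     (LEAST k. \<exists>S. independent_set G S \<and> dominating_set G S \<and> card S = k)"

text \<open>
  Only the values of \<open>g\<close> on the vertices of the graph matter below.
\<close>

definition roman2_dom_fun :: "('a, 'b) pre_digraph \<Rightarrow> ('a \<Rightarrow> nat) \<Rightarrow> bool" where
  "roman2_dom_fun G g \<longleftrightarrow>
     g ` verts G \<subseteq> {0, 1, 2} \<and>
     (\<forall>v\<in>verts G. g v = 0 \<longrightarrow> (\<Sum>u\<in>neighborhood G v. g u) \<ge> 2)"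

definition indep_roman2_dom_fun :: "('a, 'b) pre_digraph \<Rightarrow> ('a \<Rightarrow> nat) \<Rightarrow> bool" where
  "indep_roman2_dom_fun G g \<longleftrightarrow>
     roman2_dom_fun G g \<and> independent_set G {v \<in> verts G. g v > 0}"

definition fun_weight :: "('a, 'b) pre_digraph \<Rightarrow> ('a \<Rightarrow> nat) \<Rightarrow> nat" where
  "fun_weight G g = (\<Sum>v\<in>verts G. g v)"

definition indep_roman2_dom_number :: "('a, 'b) pre_digraph \<Rightarrow> nat" where
  "indep_roman2_dom_number G =
     (LEAST k. \<exists>g. indep_roman2_dom_fun G g \<and> fun_weight G g = k)"

text \<open>
  The two minima are attained in every finite simple graph.
\<close>

lemma (in graph) ex_independent_dominating:
  "\<exists>S. independent_set G S \<and> dominating_set G S"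
proof -
  have "finite {S. independent_set G S}"
    by (rule finite_subset[of _ "Pow (verts G)"]) (auto simp: independent_set_def)
  moreover have "{} \<in> {S. independent_set G S}"
    by (simp add: independent_set_def)
  ultimately obtain S where S: "independent_set G S"
    and mx: "\<And>S'. independent_set G S' \<Longrightarrow> S \<subseteq> S' \<Longrightarrow> S = S'"
    using finite_has_maximal[of "{S. independent_set G S}"] by blast
  have "neighborhood G v \<inter> S \<noteq> {}" if v: "v \<in> verts G - S" for v
  proof
    assume "neighborhood G v \<inter> S = {}"
    then have "\<not> v \<rightarrow> u \<and> \<not> u \<rightarrow> v" if "u \<in> S" for u
      using that S arcs_ends_symmetric[OF sym_arcs]
      by (auto simp: neighborhood_def independent_set_def)
    then have "independent_set G (insert v S)"
      using S v by (auto simp: independent_set_def dest: adj_not_same)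
    with mx v show False by blast
  qed
  with S show ?thesis
    by (auto simp: dominating_set_def independent_set_def)
qed

lemma (in graph) ex_indep_roman2_dom_fun: "\<exists>g. indep_roman2_dom_fun G g"
proof -
  obtain S where S: "independent_set G S" "dominating_set G S"
    using ex_independent_dominating by blast
  define g where "g v = (if v \<in> S then 2 else 0 :: nat)" for v
  have "2 \<le> (\<Sum>u\<in>neighborhood G v. g u)" if v: "v \<in> verts G" "g v = 0" for v
  proof -
    obtain w where w: "w \<in> neighborhood G v" "w \<in> S"
      using S v by (auto simp: dominating_set_def g_def split: if_splits)
    have "finite (neighborhood G v)" by (simp add: neighborhood_def)
    with w have "g w \<le> (\<Sum>u\<in>neighborhood G v. g u)" by (intro member_le_sum) auto
    with w show ?thesis by (simp add: g_def)
  qed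
  moreover have "{v \<in> verts G. g v > 0} = S"
    using S by (auto simp: independent_set_def g_def)
  ultimately have "indep_roman2_dom_fun G g"
    using S by (auto simp: indep_roman2_dom_fun_def roman2_dom_fun_def g_def)
  then show ?thesis by blast
qed

end

theory Submission
  imports Defs
begin

text \<open>
  Let \<open>g\<close> be an independent Roman \<open>{2}\<close>-dominating function of minimum weight. Its support
  \<open>S\<close> is independent and dominating, so a strict inequality holds unless \<open>g\<close> only takes the
  values 0 and 1. In that case every vertex outside \<open>S\<close> has at least two neighbours in \<open>S\<close>.
  Choose any \<open>v\<close> outside \<open>S\<close> and replace the neighbours of \<open>v\<close> in \<open>S\<close> by \<open>v\<close> itself. This
  lowers the cardinality and keeps independence. Domination survives because two vertices of a
  tree have at most one common neighbour, as otherwise there would be a 4-cycle.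
\<close>

lemma (in graph) adj_sym: "u \<rightarrow> v \<Longrightarrow> v \<rightarrow> u"
  using arcs_ends_symmetric[OF sym_arcs] by blast

text \<open>Adjacent vertices differ because there are no loops, so only the opposite pairs
  \<open>a\<close>, \<open>b\<close> and \<open>v\<close>, \<open>w\<close> must be assumed
  distinct.\<close>

lemma (in graph) four_cycle:
  assumes "v \<rightarrow> a" "a \<rightarrow> w" "w \<rightarrow> b" "b \<rightarrow> v" and "a \<noteq> b" "v \<noteq> w"
  shows "\<exists>p. cycle p \<and> length p = 4"
proof -
  obtain e1 e2 e3 e4 where e: "arc e1 (v, a)" "arc e2 (a, w)" "arc e3 (w, b)" "arc e4 (b, v)"
    using assms by (auto simp: arcs_ends_conv arc_def)
  have "cycle [e1, e2, e3, e4]"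
    using e assms adj_not_same adj_in_verts(1)[OF assms(1)]
    unfolding cycle_def
    by (intro exI[of _ v]) (auto simp: arc_def awalk_simps)
  then show ?thesis by (intro exI[of _ "[e1, e2, e3, e4]"]) simp
qed

text \<open>The first arc of a walk between two distinct vertices would have both ends in an
  independent set that contains every vertex. This supplies the vertex at which the exchange is
  made.\<close>

lemma (in graph) connected_independent_set_proper:
  assumes "connected G" "card (verts G) \<ge> 2" "independent_set G S"
  obtains v where "v \<in> verts G" "v \<notin> S"
proof -
  have "\<not> verts G \<subseteq> S"
  proof
    assume sub: "verts G \<subseteq> S"
    obtain x where x: "x \<in> verts G"
      using assms(2) by fastforce
    have "\<not> verts G \<subseteq> {x}"
      using assms(2) card_mono[of "{x}" "verts G"] by auto
    then obtain y where y: "y \<in> verts G" "y \<noteq> x"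
      by blast
    have "x \<rightarrow>\<^sup>* y"
      using symmetric_connected_imp_strongly_connected[OF sym_arcs assms(1)] x y
      by (auto simp: strongly_connected_def)
    then obtain z where "x \<rightarrow> z"
      using y(2) by (auto elim: converse_reachable_cases)
    then show False
      using sub assms(3) adj_in_verts[of x z] unfolding independent_set_def by blast
  qed
  then show ?thesis using that by blast
qed

text \<open>Assumption \<open>two\<close> serves twice: at \<open>v\<close> it makes the exchange
  lower the cardinality, and at the other vertices outside \<open>S\<close> it leaves a neighbour in
  \<open>S\<close> that is not removed.\<close>

lemma (in graph) smaller_independent_dominating:
  assumes no4: "\<not> (\<exists>p. cycle p \<and> length p = 4)"
    and S: "independent_set G S"
    and two: "\<And>w. w \<in> verts G \<Longrightarrow> w \<notin> S \<Longrightarrow> card (neighborhood G w \<inter> S) \<ge> 2"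
    and v: "v \<in> verts G" "v \<notin> S"
  shows "\<exists>S'. independent_set G S' \<and> dominating_set G S' \<and> card S' < card S"
proof -
  let ?N = "neighborhood G v"
  let ?S = "insert v (S - ?N)"
  have sub: "S \<subseteq> verts G" using S by (simp add: independent_set_def)
  then have finS: "finite S" by (rule finite_subset) simp
  have "independent_set G ?S"
    using S v unfolding independent_set_def neighborhood_def
    by (blast dest: adj_sym adj_not_same)
  moreover have "neighborhood G w \<inter> ?S \<noteq> {}" if w: "w \<in> verts G - ?S" for w
  proof (cases "w \<in> ?N")
    case True
    then show ?thesis using v by (auto simp: neighborhood_def intro: adj_sym)
  next
    case False
    then have "w \<notin> S" "w \<noteq> v" using w by auto
    \<comment> \<open>If every neighbour of \<open>w\<close> in \<open>S\<close> were removed, two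
      of them would close the 4-cycle \<open>v\<close>, \<open>a\<close>, \<open>w\<close>,
      \<open>b\<close>.\<close>
    have "neighborhood G w \<inter> S \<inter> ?N \<noteq> neighborhood G w \<inter> S"
    proof
      assume eq: "neighborhood G w \<inter> S \<inter> ?N = neighborhood G w \<inter> S"
      have "\<not> card (neighborhood G w \<inter> S) \<le> Suc 0"
        using two[of w] w \<open>w \<notin> S\<close> by simp
      then obtain a b where "a \<in> neighborhood G w \<inter> S" "b \<in> neighborhood G w \<inter> S" "a \<noteq> b"
        using card_le_Suc0_iff_eq[of "neighborhood G w \<inter> S"] finS by auto
      moreover from this have "a \<in> ?N" "b \<in> ?N" using eq by blast+
      ultimately show False
        using four_cycle[of v a w b] no4 \<open>w \<noteq> v\<close> unfolding neighborhood_def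
        by (blast dest: adj_sym)
    qed
    then show ?thesis by blast
  qed
  then have "dominating_set G ?S"
    using sub v by (auto simp: dominating_set_def)
  moreover have "card ?S < card S"
  proof -
    have "card S = card (S - ?N) + card (?N \<inter> S)"
      \<comment> \<open>The bound from \<open>card_mono\<close> keeps the subtraction on naturals
        from truncating.\<close>
      using card_Diff_subset_Int[of S ?N] finS card_mono[of S "S \<inter> ?N"]
      by (simp add: Int_commute)
    moreover have "card ?S = Suc (card (S - ?N))" using finS v by simp
    ultimately show ?thesis using two[OF v] by simp
  qed
  ultimately show ?thesis by blast
qed

lemma indep_dom_number_le:
  assumes "independent_set G S" "dominating_set G S"
  shows "indep_dom_number G \<le> card S"
  unfolding indep_dom_number_def using assms by (intro Least_le) blast

lemma (in graph) indep_dom_number_less_weight: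
  assumes conn: "connected G" and no4: "\<not> (\<exists>p. cycle p \<and> length p = 4)"
    and two: "card (verts G) \<ge> 2" and g: "indep_roman2_dom_fun G g"
  shows "indep_dom_number G < fun_weight G g"
proof -
  define S where "S = {v \<in> verts G. g v > 0}"
  have S: "independent_set G S" using g by (simp add: indep_roman2_dom_fun_def S_def)
  have finS: "finite S" by (simp add: S_def)
  have finN: "finite (neighborhood G v)" for v by (simp add: neighborhood_def)
  have wt: "fun_weight G g = (\<Sum>v\<in>S. g v)"
    unfolding fun_weight_def S_def by (rule sum.mono_neutral_right) auto
  have nb: "(\<Sum>u\<in>neighborhood G v \<inter> S. g u) \<ge> 2" if "v \<in> verts G" "v \<notin> S" for v
  proof -
    have "(\<Sum>u\<in>neighborhood G v \<inter> S. g u) = (\<Sum>u\<in>neighborhood G v. g u)"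
      using finN by (intro sum.mono_neutral_left) (auto simp: S_def neighborhood_def)
    then show ?thesis
      using g that by (auto simp: indep_roman2_dom_fun_def roman2_dom_fun_def S_def)
  qed
  show ?thesis
  proof (cases "\<exists>v\<in>S. g v > 1")
    case True
    \<comment> \<open>By \<open>nb\<close>, a vertex outside \<open>S\<close> cannot have an empty
      sum over its neighbours in \<open>S\<close>.\<close>
    have "dominating_set G S"
      using nb by (fastforce simp: dominating_set_def S_def)
    then have "indep_dom_number G \<le> (\<Sum>v\<in>S. 1)"
      using indep_dom_number_le[OF S] by simp
    \<comment> \<open>Every value on \<open>S\<close> is at least 1, and some value exceeds
      1.\<close>
    also have "\<dots> < (\<Sum>v\<in>S. g v)"
      using True finS by (intro sum_strict_mono_ex1) (auto simp: S_def)
    finally show ?thesis using wt by simp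
  next
    case False
    then have one: "g u = 1" if "u \<in> S" for u
      using that by (force simp: S_def)
    \<comment> \<open>With all values on \<open>S\<close> equal to 1, the sum in \<open>nb\<close>
      counts neighbours.\<close>
    have "card (neighborhood G w \<inter> S) \<ge> 2" if "w \<in> verts G" "w \<notin> S" for w
      using nb[OF that] one by simp
    moreover obtain v where "v \<in> verts G" "v \<notin> S"
      using connected_independent_set_proper[OF conn two S] .
    ultimately obtain S' where "independent_set G S'" "dominating_set G S'" "card S' < card S"
      using smaller_independent_dominating[OF no4 S] by blast
    then have "indep_dom_number G < card S"
      using indep_dom_number_le le_less_trans by blast
    then show ?thesis using wt one by simp
  qed
qed

theorem theorem14:
  fixes T :: "('a, 'b) pre_digraph"
  assumes "undirected_tree T"
    and "card (verts T) \<ge> 2"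
  shows "indep_roman2_dom_number T \<ge> indep_dom_number T + 1"
proof -
  interpret graph T using assms(1) by (simp add: undirected_tree_def)
  have "connected T" "\<not> (\<exists>p. cycle p \<and> length p = 4)"
    using assms(1) by (auto simp: undirected_tree_def)
  then have less: "indep_dom_number T < fun_weight T g" if "indep_roman2_dom_fun T g" for g
    using indep_dom_number_less_weight assms(2) that by blast
  \<comment> \<open>The minimum is attained, so the strict bound for each single function carries
    over to it.\<close>
  have "\<exists>g. indep_roman2_dom_fun T g \<and> fun_weight T g = indep_roman2_dom_number T"
    unfolding indep_roman2_dom_number_def
    by (rule LeastI_ex) (use ex_indep_roman2_dom_fun in blast)
  then show ?thesis using less by fastforce
qed

end
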